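(* There is a monoidal natural transformation $\mathsf{netflow}\colon\mathsf{FlowNet}\Rightarrow\mathsf{Conc}$ whose component at a finite set $N$, $\mathsf{netflow}_N\colon\mathsf{FlowNet}(N)\to\mathsf{Conc}(N)$, takes a flow network $G=(E,s,t,\ell,b)$ on $N$ vertices to the concave function $$\lambda\mapsto\inf_{x\in\mathbb{R}^E}\ \sum_{e\in E}\ell(e)(x_e)+\lambda^T(Ax-b),$$ where $A$ is the node incidence matrix of $G$.
   Context: $(\mathbf{FinSet},+)$ is finite sets with disjoint union as monoidal product; $(\mathbf{Set},\times)$ is sets with Cartesian product. For a finite set $N$, $\mathbb{R}^N$ is the vector space of functions $N\to\mathbb{R}$; for $\phi\colon N\to M$, $\phi^*\colon\mathbb{R}^M\to\mathbb{R}^N$ is $\phi^*(y)_i=y_{\phi(i)}$ and $\phi_*\colon\mathbb{R}^N\to\mathbb{R}^M$ is $\phi_*(x)_j=\sum_{i\in\phi^{-1}(j)}x_i$. $\iota_N,\iota_M$ are the inclusions of $N,M$ into $N+M$; $[\cdot,\cdot]$ is copairing. Let $K=\{\kappa\colon\mathbb{R}\to\mathbb{R}\mid\kappa\in C^1\text{ and convex}\}$, where $C^1$ means once-continuously-differentiable. A flow network on a finite vertex set $N$ is a tuple $(E,s,t,\ell,b)$ with $E$ a finite set of edges, $s,t\colon E\to N$ the source and target maps, $\ell\colon E\to K$ assigning a flow cost function to each edge, and $b\colon N\to\mathbb{R}$ (regarded as a vector in $\mathbb{R}^N$) with $\mathbf{1}^Tb=0$. Its node incidence matrix $A\in\mathbb{R}^{N\times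 E}$ has $A_{v,e}=0$ if $s(e)=t(e)=v$; otherwise $A_{v,e}=1$ if $s(e)=v$, $A_{v,e}=-1$ if $t(e)=v$, and $A_{v,e}=0$ in all remaining cases. $\mathsf{FlowNet}\colon(\mathbf{FinSet},+)\to(\mathbf{Set},\times)$ is the lax symmetric monoidal functor (technically only a lax symmetric monoidal pseudofunctor, since some of the required diagrams hold only up to canonical isomorphism) with $\mathsf{FlowNet}(N)$ the set of flow networks on $N$; $\mathsf{FlowNet}(\phi)(E,s,t,\ell,b)=(E,\phi\circ s,\phi\circ t,\ell,\phi_*(b))$; product comparison sending $(E_1,s_1,t_1,\ell_1,b_1),(E_2,s_2,t_2,\ell_2,b_2)$ to their disjoint union $(E_1+E_2,s_1+s_2,t_1+t_2,[\ell_1,\ell_2],[b_1,b_2])$; unit comparison the unique map to the singleton $\mathsf{FlowNet}(\emptyset)$. $\mathsf{Conc}\colon(\mathbf{FinSet},+)\to(\mathbf{Set},\times)$ is the lax symmetric monoidal functor with $\mathsf{Conc}(N)$ the set of concave functions $f\colon\mathbb{R}^N\to\mathbb{R}$; $\mathsf{Conc}(\phi)(f)=f\circ\phi^*$; product comparison $(f,g)\mapsto f\circ\iota_N^*+g\circ\iota_M^*$; unit comparison picking the zero function on $\mathbb{R}^0$.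
   Formalization: Conc(N) is taken to be concave functions from R^N to R together with −∞ (never +∞), since the infimum can be −∞ (for example, one zero-cost edge between two distinct vertices), so netflow_N(G) need not be real-valued. *)

theory Defs
  imports "HOL-Analysis.Analysis"
begin

section \<open>Finite sets with disjoint union\<close>

text \<open>
  HOL has no type of all finite sets, so the objects of FinSet are the finite subsets of a universe
  that is freely closed under tagging. The type parameter is arbitrary, so every
  finite set of every type occurs (as a set of atoms), and disjoint unions stay within the universe.
  Morphisms from \<open>N\<close> to \<open>M\<close> are the extensional functions \<open>N \<rightarrow>\<^sub>E M\<close>, composed with \<open>compose\<close>, so that
  equality of morphisms is equality in HOL. The monoidal unit is the empty set.
\<close>

datatype 'a point = Atom 'a | InL "'a point" | InR "'a point"

definition dsum :: "'a point set \<Rightarrow> 'a point set \<Rightarrow> 'a point set"  (infixr "\<uplus>" 65)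
  where "N \<uplus> M = InL ` N \<union> InR ` M"

primrec copair :: "('a point \<Rightarrow> 'c) \<Rightarrow> ('a point \<Rightarrow> 'c) \<Rightarrow> 'a point \<Rightarrow> 'c"
  where
    "copair f g (InL p) = f p"
  | "copair f g (InR p) = g p"
  | "copair f g (Atom a) = undefined"

definition sum_map :: "'a point set \<Rightarrow> 'a point set \<Rightarrow>
    ('a point \<Rightarrow> 'b point) \<Rightarrow> ('a point \<Rightarrow> 'b point) \<Rightarrow> 'a point \<Rightarrow> 'b point"
  where "sum_map N M \<phi> \<psi> = restrict (copair (InL \<circ> \<phi>) (InR \<circ> \<psi>)) (N \<uplus> M)"

definition associator :: "'a point set \<Rightarrow> 'a point set \<Rightarrow> 'a point set \<Rightarrow> 'a point \<Rightarrow> 'a point"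
  where "associator N M P =
    restrict (copair (copair InL (InR \<circ> InL)) (InR \<circ> InR)) ((N \<uplus> M) \<uplus> P)"

definition left_unitor :: "'a point set \<Rightarrow> 'a point \<Rightarrow> 'a point"
  where "left_unitor N = restrict (copair (\<lambda>_. undefined) (\<lambda>p. p)) ({} \<uplus> N)"

definition right_unitor :: "'a point set \<Rightarrow> 'a point \<Rightarrow> 'a point"
  where "right_unitor N = restrict (copair (\<lambda>p. p) (\<lambda>_. undefined)) (N \<uplus> {})"

definition braiding :: "'a point set \<Rightarrow> 'a point set \<Rightarrow> 'a point \<Rightarrow> 'a point"
  where "braiding N M = restrict (copair InR InL) (N \<uplus> M)"


section \<open>Lax symmetric monoidal functors (FinSet, +) to (Set, \<open>\<times>\<close>)\<close>

text \<open>
  \<open>Ob F N\<close> is the set \<open>F(N)\<close>, \<open>Ar F N M \<phi>\<close> the map \<open>F(\<phi>)\<close>, \<open>Pr F N M\<close> the product comparison from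
  \<open>F(N) \<times> F(M)\<close> to \<open>F(N + M)\<close>, and \<open>Unt F\<close> the element of \<open>F({})\<close> picked by the unit comparison.

  \<open>Eq F N\<close> is an equivalence relation on \<open>F(N)\<close>, to be read as "isomorphic". It accounts
  for pseudofunctors such as \<open>FlowNet\<close>, whose associativity, unit and symmetry diagrams commute
  only up to isomorphism. Functoriality and naturality of the product comparison are required as
  equalities. An ordinary lax symmetric monoidal functor is the case where \<open>Eq F N\<close> is the
  identity relation on \<open>F(N)\<close>.
\<close>

record ('a, 'x) lax_data =
  Ob :: "'a point set \<Rightarrow> 'x set"
  Eq :: "'a point set \<Rightarrow> ('x \<times> 'x) set"
  Ar :: "'a point set \<Rightarrow> 'a point set \<Rightarrow> ('a point \<Rightarrow> 'a point) \<Rightarrow> 'x \<Rightarrow> 'x"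
  Pr :: "'a point set \<Rightarrow> 'a point set \<Rightarrow> 'x \<times> 'x \<Rightarrow> 'x"
  Unt :: "'x"

locale lax_symmetric_monoidal_functor =
  fixes F :: "('a, 'x) lax_data"
  assumes equiv_Eq: "finite N \<Longrightarrow> equiv (Ob F N) (Eq F N)"
    and Ar_closed: "\<lbrakk>finite N; finite M; \<phi> \<in> N \<rightarrow>\<^sub>E M; x \<in> Ob F N\<rbrakk> \<Longrightarrow> Ar F N M \<phi> x \<in> Ob F M"
    and Ar_Eq: "\<lbrakk>finite N; finite M; \<phi> \<in> N \<rightarrow>\<^sub>E M; (x, x') \<in> Eq F N\<rbrakk>
      \<Longrightarrow> (Ar F N M \<phi> x, Ar F N M \<phi> x') \<in> Eq F M"
    and Ar_id: "\<lbrakk>finite N; x \<in> Ob F N\<rbrakk> \<Longrightarrow> Ar F N N (\<lambda>i\<in>N. i) x = x"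
    and Ar_comp: "\<lbrakk>finite N; finite M; finite P; \<phi> \<in> N \<rightarrow>\<^sub>E M; \<psi> \<in> M \<rightarrow>\<^sub>E P; x \<in> Ob F N\<rbrakk>
      \<Longrightarrow> Ar F N P (compose N \<psi> \<phi>) x = Ar F M P \<psi> (Ar F N M \<phi> x)"
    and Pr_closed: "\<lbrakk>finite N; finite M; x \<in> Ob F N; y \<in> Ob F M\<rbrakk>
      \<Longrightarrow> Pr F N M (x, y) \<in> Ob F (N \<uplus> M)"
    and Pr_Eq: "\<lbrakk>finite N; finite M; (x, x') \<in> Eq F N; (y, y') \<in> Eq F M\<rbrakk>
      \<Longrightarrow> (Pr F N M (x, y), Pr F N M (x', y')) \<in> Eq F (N \<uplus> M)"
    and Pr_natural: "\<lbrakk>finite N; finite M; finite N'; finite M';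
        \<phi> \<in> N \<rightarrow>\<^sub>E N'; \<psi> \<in> M \<rightarrow>\<^sub>E M'; x \<in> Ob F N; y \<in> Ob F M\<rbrakk>
      \<Longrightarrow> Ar F (N \<uplus> M) (N' \<uplus> M') (sum_map N M \<phi> \<psi>) (Pr F N M (x, y))
        = Pr F N' M' (Ar F N N' \<phi> x, Ar F M M' \<psi> y)"
    and Unt_closed: "Unt F \<in> Ob F {}"
    and assoc: "\<lbrakk>finite N; finite M; finite P; x \<in> Ob F N; y \<in> Ob F M; z \<in> Ob F P\<rbrakk>
      \<Longrightarrow> (Ar F ((N \<uplus> M) \<uplus> P) (N \<uplus> (M \<uplus> P)) (associator N M P)
             (Pr F (N \<uplus> M) P (Pr F N M (x, y), z)),
           Pr F N (M \<uplus> P) (x, Pr F M P (y, z))) \<in> Eq F (N \<uplus> (M \<uplus> P))"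
    and left_unit: "\<lbrakk>finite N; x \<in> Ob F N\<rbrakk>
      \<Longrightarrow> (Ar F ({} \<uplus> N) N (left_unitor N) (Pr F {} N (Unt F, x)), x) \<in> Eq F N"
    and right_unit: "\<lbrakk>finite N; x \<in> Ob F N\<rbrakk>
      \<Longrightarrow> (Ar F (N \<uplus> {}) N (right_unitor N) (Pr F N {} (x, Unt F)), x) \<in> Eq F N"
    and symmetry: "\<lbrakk>finite N; finite M; x \<in> Ob F N; y \<in> Ob F M\<rbrakk>
      \<Longrightarrow> (Ar F (N \<uplus> M) (M \<uplus> N) (braiding N M) (Pr F N M (x, y)),
           Pr F M N (y, x)) \<in> Eq F (M \<uplus> N)"

locale monoidal_natural_transformation =
  F: lax_symmetric_monoidal_functor F + G: lax_symmetric_monoidal_functor G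
  for F :: "('a, 'x) lax_data" and G :: "('a, 'y) lax_data" +
  fixes \<eta> :: "'a point set \<Rightarrow> 'x \<Rightarrow> 'y"
  assumes component: "\<lbrakk>finite N; x \<in> Ob F N\<rbrakk> \<Longrightarrow> \<eta> N x \<in> Ob G N"
    and component_Eq: "\<lbrakk>finite N; (x, x') \<in> Eq F N\<rbrakk> \<Longrightarrow> (\<eta> N x, \<eta> N x') \<in> Eq G N"
    and natural: "\<lbrakk>finite N; finite M; \<phi> \<in> N \<rightarrow>\<^sub>E M; x \<in> Ob F N\<rbrakk>
      \<Longrightarrow> Ar G N M \<phi> (\<eta> N x) = \<eta> M (Ar F N M \<phi> x)"
    and monoidal_product: "\<lbrakk>finite N; finite M; x \<in> Ob F N; y \<in> Ob F M\<rbrakk>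
      \<Longrightarrow> \<eta> (N \<uplus> M) (Pr F N M (x, y)) = Pr G N M (\<eta> N x, \<eta> M y)"
    and monoidal_unit: "\<eta> {} (Unt F) = Unt G"


section \<open>Vectors indexed by a finite set\<close>

definition vecs :: "'a set \<Rightarrow> ('a \<Rightarrow> real) set"
  where "vecs N = N \<rightarrow>\<^sub>E UNIV"

definition pull :: "'a set \<Rightarrow> ('a \<Rightarrow> 'b) \<Rightarrow> ('b \<Rightarrow> real) \<Rightarrow> 'a \<Rightarrow> real"
  where "pull N \<phi> y = (\<lambda>i\<in>N. y (\<phi> i))"

definition push :: "'a set \<Rightarrow> 'b set \<Rightarrow> ('a \<Rightarrow> 'b) \<Rightarrow> ('a \<Rightarrow> real) \<Rightarrow> 'b \<Rightarrow> real"
  where "push N M \<phi> x = (\<lambda>j\<in>M. \<Sum>i | i \<in> N \<and> \<phi> i = j. x i)"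


section \<open>Flow networks\<close>

definition K :: "(real \<Rightarrow> real) set"
  where "K = {\<kappa>. \<kappa> C1_differentiable_on UNIV \<and> convex_on UNIV \<kappa>}"

record ('a, 'e) flow_network =
  edges :: "'e point set"
  src :: "'e point \<Rightarrow> 'a point"
  tgt :: "'e point \<Rightarrow> 'a point"
  cost :: "'e point \<Rightarrow> real \<Rightarrow> real"
  vertex_supply :: "'a point \<Rightarrow> real"

definition flow_networks :: "'a point set \<Rightarrow> ('a, 'e) flow_network set"
  where "flow_networks N = {G. finite (edges G)
    \<and> src G \<in> edges G \<rightarrow>\<^sub>E N \<and> tgt G \<in> edges G \<rightarrow>\<^sub>E N
    \<and> cost G \<in> edges G \<rightarrow>\<^sub>E K
    \<and> vertex_supply G \<in> vecs N \<and> (\<Sum>v\<in>N. vertex_supply G v) = 0}"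

definition incidence :: "('a, 'e) flow_network \<Rightarrow> 'a point \<Rightarrow> 'e point \<Rightarrow> real"
  where "incidence G v e =
    (if src G e = v \<and> tgt G e = v then 0
     else if src G e = v then 1
     else if tgt G e = v then -1
     else 0)"

definition flow_network_iso :: "'a point set \<Rightarrow> (('a, 'e) flow_network \<times> ('a, 'e) flow_network) set"
  where "flow_network_iso N = {(G, H). G \<in> flow_networks N \<and> H \<in> flow_networks N
    \<and> vertex_supply G = vertex_supply H
    \<and> (\<exists>\<beta>. bij_betw \<beta> (edges G) (edges H) \<and>
          (\<forall>e\<in>edges G. src H (\<beta> e) = src G e \<and> tgt H (\<beta> e) = tgt G e \<and> cost H (\<beta> e) = cost G e))}"

definition FlowNet :: "('a, ('a, 'e) flow_network) lax_data"
  where "FlowNet = \<lparr>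
    Ob = flow_networks,
    Eq = flow_network_iso,
    Ar = (\<lambda>N M \<phi> G. \<lparr>edges = edges G,
            src = compose (edges G) \<phi> (src G), tgt = compose (edges G) \<phi> (tgt G),
            cost = cost G, vertex_supply = push N M \<phi> (vertex_supply G)\<rparr>),
    Pr = (\<lambda>N M (G, H). \<lparr>edges = edges G \<uplus> edges H,
            src = sum_map (edges G) (edges H) (src G) (src H),
            tgt = sum_map (edges G) (edges H) (tgt G) (tgt H),
            cost = copair (cost G) (cost H), vertex_supply = copair (vertex_supply G) (vertex_supply H)\<rparr>),
    Unt = \<lparr>edges = {}, src = (\<lambda>_. undefined), tgt = (\<lambda>_. undefined),
          cost = (\<lambda>_. undefined), vertex_supply = (\<lambda>_. undefined)\<rparr>\<rparr>"


section \<open>Concave functions\<close>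

text \<open>
  The dual function of a flow network may take the value \<open>-\<infinity>\<close>: \<open>K\<close> contains the affine
  functions, and for a single edge with zero cost between distinct vertices \<open>v\<close> and \<open>w\<close> the infimum
  is \<open>-\<infinity>\<close> at every \<open>y\<close> with \<open>y v \<noteq> y w\<close>. Concave functions are therefore taken in the
  usual extended sense of convex analysis, with values in the reals together with \<open>-\<infinity>\<close>; the function
  that is constantly \<open>-\<infinity>\<close> is allowed (it arises from a self-loop with cost function \<open>\<lambda>x. x\<close>).
  The restriction to \<open>0 < t < 1\<close> is immaterial, as the inequality is trivial at the end points.
\<close>

definition concave_functions :: "'a set \<Rightarrow> (('a \<Rightarrow> real) \<Rightarrow> ereal) set"
  where "concave_functions N = {f. f \<in> vecs N \<rightarrow>\<^sub>E - {\<infinity>}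
    \<and> (\<forall>x\<in>vecs N. \<forall>y\<in>vecs N. \<forall>t. 0 < t \<and> t < 1 \<longrightarrow>
         ereal (1 - t) * f x + ereal t * f y \<le> f (\<lambda>i\<in>N. (1 - t) * x i + t * y i))}"

lemma real_valued_concave_functions_iff:
  fixes g :: "('a \<Rightarrow> real) \<Rightarrow> real"
  shows "restrict (\<lambda>x. ereal (g x)) (vecs N) \<in> concave_functions N \<longleftrightarrow>
    (\<forall>x\<in>vecs N. \<forall>y\<in>vecs N. \<forall>t. 0 \<le> t \<and> t \<le> 1 \<longrightarrow>
       (1 - t) * g x + t * g y \<le> g (\<lambda>i\<in>N. (1 - t) * x i + t * y i))"
    (is "?l \<longleftrightarrow> ?r")
proof -
  have vec: "(\<lambda>i\<in>N. h i) \<in> vecs N" for h :: "'a \<Rightarrow> real"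
    by (simp add: vecs_def)
  have "?l \<longleftrightarrow> (\<forall>x\<in>vecs N. \<forall>y\<in>vecs N. \<forall>t. 0 < t \<and> t < 1 \<longrightarrow>
       (1 - t) * g x + t * g y \<le> g (\<lambda>i\<in>N. (1 - t) * x i + t * y i))"
    by (simp add: concave_functions_def vec)
  also have "\<dots> \<longleftrightarrow> ?r"
  proof (intro iffI ballI allI impI)
    fix x y and t :: real
    assume *: "\<forall>x\<in>vecs N. \<forall>y\<in>vecs N. \<forall>t. 0 < t \<and> t < 1 \<longrightarrow>
       (1 - t) * g x + t * g y \<le> g (\<lambda>i\<in>N. (1 - t) * x i + t * y i)"
      and x: "x \<in> vecs N" and y: "y \<in> vecs N" and t: "0 \<le> t \<and> t \<le> 1"
    have "restrict x N = x" "restrict y N = y"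
      using x y by (auto simp: vecs_def)
    then show "(1 - t) * g x + t * g y \<le> g (\<lambda>i\<in>N. (1 - t) * x i + t * y i)"
      using * x y t by (cases "t = 0 \<or> t = 1") auto
  qed auto
  finally show ?thesis .
qed

definition Conc :: "('a, ('a point \<Rightarrow> real) \<Rightarrow> ereal) lax_data"
  where "Conc = \<lparr>
    Ob = concave_functions,
    Eq = (\<lambda>N. Id_on (concave_functions N)),
    Ar = (\<lambda>N M \<phi> f. compose (vecs M) f (pull N \<phi>)),
    Pr = (\<lambda>N M (f, g). \<lambda>y\<in>vecs (N \<uplus> M). f (pull N InL y) + g (pull M InR y)),
    Unt = (\<lambda>y\<in>vecs {}. 0)\<rparr>"

end

theory Submission
  imports Defs
begin

text \<open>
  Everything rests on exchanging the two sums in the Lagrangian. In \<open>\<lambda>\<^sup>T (A x - b)\<close> the edge \<open>e\<close>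
  contributes \<open>x e\<close> times its tension \<open>\<lambda> (s e) - \<lambda> (t e)\<close>; a self-loop has tension 0, in agreement
  with its zero column in the incidence matrix. Hence (\<open>lagrangian_tension\<close>) the Lagrangian is the
  sum of \<open>cost e (x e) + (\<lambda> (s e) - \<lambda> (t e)) * x e\<close> over all edges, minus \<open>\<lambda>\<^sup>T b\<close>. The vertices
  enter this formula only through the values of \<open>\<lambda>\<close> at end points and through the pairing with \<open>b\<close>.

  \<^item> Naturality: pulling \<open>\<lambda>\<close> back along \<open>\<phi>\<close> changes the tensions exactly as composing source and
    target with \<open>\<phi>\<close> does, and \<open>\<phi>\<^sub>*\<close> is adjoint to \<open>\<phi>\<^sup>*\<close> (\<open>sum_pull_push\<close>), so the two
    Lagrangians agree for each flow \<open>x\<close>, before the infimum is taken.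
  \<^item> Monoidality: the Lagrangian of a disjoint union is the sum of the Lagrangians of the summands,
    and a flow on \<open>E + E'\<close> is an arbitrary pair of flows (\<open>pull_dsum_image\<close>). The infimum of a
    separable function over a product is the sum of the infima (\<open>INF_add_Times\<close>); this holds even
    when an infimum is \<open>-\<infinity>\<close>, because neither of them is \<open>\<infinity>\<close>.
  \<^item> Invariance under isomorphism: relabelling the edges permutes the terms of the sum and
    reparametrises the infimum.
  \<^item> Concavity: for each flow the Lagrangian is affine in \<open>\<lambda>\<close>, and an infimum of affine
    functions is concave.

  That the two functors satisfy the axioms is bookkeeping. For flow networks, the
  coherence isomorphism of \<open>(FinSet, +)\<close> for the sets of edges serves as the isomorphism of
  networks that makes the corresponding diagram for the sets of vertices commute.
\<close>

section \<open>Disjoint unions, pullback and pushforward\<close>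

lemma in_dsum [simp]:
  "InL p \<in> N \<uplus> M \<longleftrightarrow> p \<in> N" "InR p \<in> N \<uplus> M \<longleftrightarrow> p \<in> M" "Atom a \<notin> N \<uplus> M"
  by (auto simp: dsum_def)

lemma dsum_cases [consumes 1, case_names InL InR]:
  assumes "p \<in> N \<uplus> M"
  obtains q where "p = InL q" "q \<in> N" | q where "p = InR q" "q \<in> M"
  using assms by (auto simp: dsum_def)

lemma finite_dsum [simp]: "finite N \<Longrightarrow> finite M \<Longrightarrow> finite (N \<uplus> M)"
  by (simp add: dsum_def)

lemma sum_dsum:
  assumes "finite N" "finite M"
  shows "sum f (N \<uplus> M) = (\<Sum>p\<in>N. f (InL p)) + (\<Sum>p\<in>M. f (InR p))"
proof -
  have "sum f (N \<uplus> M) = sum f (InL ` N) + sum f (InR ` M)"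
    unfolding dsum_def using assms by (intro sum.union_disjoint) auto
  then show ?thesis
    by (simp add: sum.reindex inj_on_def)
qed

lemma copair_extensional:
  "f \<in> N \<rightarrow>\<^sub>E A \<Longrightarrow> g \<in> M \<rightarrow>\<^sub>E A \<Longrightarrow> copair f g \<in> N \<uplus> M \<rightarrow>\<^sub>E A"
proof (rule PiE_I)
  \<comment> \<open>As \<open>copair\<close> is not restricted to the disjoint union, its extensionality comes from \<open>f\<close> and \<open>g\<close>.\<close>
  fix p assume "f \<in> N \<rightarrow>\<^sub>E A" "g \<in> M \<rightarrow>\<^sub>E A" "p \<notin> N \<uplus> M"
  then show "copair f g p = undefined"
    by (cases p) auto
qed (auto elim!: dsum_cases)

lemma sum_map_closed:
  "\<phi> \<in> N \<rightarrow>\<^sub>E N' \<Longrightarrow> \<psi> \<in> M \<rightarrow>\<^sub>E M' \<Longrightarrow> sum_map N M \<phi> \<psi> \<in> N \<uplus> M \<rightarrow>\<^sub>E N' \<uplus> M'"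
  by (auto simp: sum_map_def elim!: dsum_cases)

lemma sum_map_apply [simp]:
  "p \<in> N \<Longrightarrow> sum_map N M \<phi> \<psi> (InL p) = InL (\<phi> p)"
  "q \<in> M \<Longrightarrow> sum_map N M \<phi> \<psi> (InR q) = InR (\<psi> q)"
  by (simp_all add: sum_map_def)

lemma compose_sum_map:
  "compose (N \<uplus> M) (sum_map N' M' \<phi>' \<psi>') (sum_map N M \<phi> \<psi>) =
    sum_map N M (compose N \<phi>' \<phi>) (compose M \<psi>' \<psi>)"
  if "\<phi> \<in> N \<rightarrow> N'" "\<psi> \<in> M \<rightarrow> M'"
  using that by (auto simp: fun_eq_iff compose_def sum_map_def elim!: dsum_cases)

lemma coherence_apply [simp]:
  "p \<in> N \<Longrightarrow> associator N M P (InL (InL p)) = InL p"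
  "q \<in> M \<Longrightarrow> associator N M P (InL (InR q)) = InR (InL q)"
  "r \<in> P \<Longrightarrow> associator N M P (InR r) = InR (InR r)"
  "p \<in> N \<Longrightarrow> left_unitor N (InR p) = p"
  "p \<in> N \<Longrightarrow> right_unitor N (InL p) = p"
  "p \<in> N \<Longrightarrow> braiding N M (InL p) = InR p"
  "q \<in> M \<Longrightarrow> braiding N M (InR q) = InL q"
  by (simp_all add: associator_def left_unitor_def right_unitor_def braiding_def)

lemma associator_closed: "associator N M P \<in> (N \<uplus> M) \<uplus> P \<rightarrow>\<^sub>E N \<uplus> (M \<uplus> P)"
  by (auto simp: associator_def elim!: dsum_cases)

lemma left_unitor_closed: "left_unitor N \<in> {} \<uplus> N \<rightarrow>\<^sub>E N"
  by (auto simp: left_unitor_def elim!: dsum_cases)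

lemma right_unitor_closed: "right_unitor N \<in> N \<uplus> {} \<rightarrow>\<^sub>E N"
  by (auto simp: right_unitor_def elim!: dsum_cases)

lemma braiding_closed: "braiding N M \<in> N \<uplus> M \<rightarrow>\<^sub>E M \<uplus> N"
  by (auto simp: braiding_def elim!: dsum_cases)

lemma bij_associator: "bij_betw (associator N M P) ((N \<uplus> M) \<uplus> P) (N \<uplus> (M \<uplus> P))"
  by (rule bij_betw_byWitness[where f' = "copair (InL \<circ> InL) (copair (InL \<circ> InR) InR)"])
    (auto simp: associator_def elim!: dsum_cases)

lemma bij_left_unitor: "bij_betw (left_unitor N) ({} \<uplus> N) N"
  by (rule bij_betw_byWitness[where f' = InR]) (auto simp: left_unitor_def elim!: dsum_cases)

lemma bij_right_unitor: "bij_betw (right_unitor N) (N \<uplus> {}) N"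
  by (rule bij_betw_byWitness[where f' = InL]) (auto simp: right_unitor_def elim!: dsum_cases)

lemma bij_braiding: "bij_betw (braiding N M) (N \<uplus> M) (M \<uplus> N)"
  by (rule bij_betw_byWitness[where f' = "copair InR InL"])
    (auto simp: braiding_def elim!: dsum_cases)

lemma pull_closed [simp]: "pull N \<phi> y \<in> vecs N"
  by (simp add: pull_def vecs_def)

lemma push_closed [simp]: "push N M \<phi> x \<in> vecs M"
  by (simp add: push_def vecs_def)

text \<open>
  Pushforward is adjoint to pullback for the standard pairing: group the sum over \<open>N\<close> by the
  fibres of \<open>\<phi>\<close>. Pairing with the constant function 1 then shows that the total supply is preserved.
\<close>

lemma sum_pull_push:
  assumes "finite N" "finite M" "\<phi> \<in> N \<rightarrow> M"
  shows "(\<Sum>i\<in>N. y (\<phi> i) * x i) = (\<Sum>j\<in>M. y j * push N M \<phi> x j)"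
proof -
  have "(\<Sum>i\<in>N. y (\<phi> i) * x i) = (\<Sum>j\<in>M. \<Sum>i | i \<in> N \<and> \<phi> i = j. y (\<phi> i) * x i)"
    using assms by (intro sum.group[symmetric]) auto
  also have "\<dots> = (\<Sum>j\<in>M. y j * push N M \<phi> x j)"
    by (intro sum.cong) (auto simp: push_def sum_distrib_left intro!: sum.cong)
  finally show ?thesis .
qed

lemma sum_push:
  assumes "finite N" "finite M" "\<phi> \<in> N \<rightarrow> M"
  shows "(\<Sum>j\<in>M. push N M \<phi> x j) = (\<Sum>i\<in>N. x i)"
  using sum_pull_push[OF assms, of "\<lambda>_. 1" x] by simp

lemma push_id: "x \<in> vecs N \<Longrightarrow> push N N (\<lambda>i\<in>N. i) x = x"
proof
  fix j assume x: "x \<in> vecs N"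
  show "push N N (\<lambda>i\<in>N. i) x j = x j"
  proof (cases "j \<in> N")
    case True
    then have "{i. i \<in> N \<and> (\<lambda>i\<in>N. i) i = j} = {j}" by auto
    with True show ?thesis by (simp add: push_def)
  qed (use x in \<open>auto simp: push_def vecs_def PiE_def extensional_def\<close>)
qed

text \<open>
  Along a bijection pushforward only relabels coordinates. This settles the supply vectors in all
  the coherence diagrams.
\<close>

lemma push_bij:
  assumes "bij_betw \<phi> N M" "y \<in> vecs M" "\<And>i. i \<in> N \<Longrightarrow> x i = y (\<phi> i)"
  shows "push N M \<phi> x = y"
proof
  fix j
  show "push N M \<phi> x j = y j"
  proof (cases "j \<in> M")
    case True
    then obtain i where i: "i \<in> N" "j = \<phi> i"
      using assms(1) by (auto simp: bij_betw_def)
    then have "{i'. i' \<in> N \<and> \<phi> i' = j} = {i}"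
      using assms(1) by (auto simp: bij_betw_def inj_on_def)
    with True i assms(3) show ?thesis by (simp add: push_def)
  qed (use assms(2) in \<open>auto simp: push_def vecs_def PiE_def extensional_def\<close>)
qed

lemma push_compose:
  assumes "finite N" "finite M" "\<phi> \<in> N \<rightarrow> M"
  shows "push N P (compose N \<psi> \<phi>) x = push M P \<psi> (push N M \<phi> x)"
proof
  fix k
  \<comment> \<open>A fibre sum is the pairing with an indicator function, so adjointness applies to it.\<close>
  have fib: "{i. i \<in> N \<and> compose N \<psi> \<phi> i = k} = {i. i \<in> N \<and> \<psi> (\<phi> i) = k}"
    by (auto simp: compose_eq)
  have "(\<Sum>i | i \<in> N \<and> \<psi> (\<phi> i) = k. x i) = (\<Sum>i\<in>N. of_bool (\<psi> (\<phi> i) = k) * x i)"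
    using assms(1) by (intro sum.mono_neutral_cong_left) auto
  also have "\<dots> = (\<Sum>j\<in>M. of_bool (\<psi> j = k) * push N M \<phi> x j)"
    by (rule sum_pull_push[OF assms, of "\<lambda>j. of_bool (\<psi> j = k)"])
  also have "\<dots> = (\<Sum>j | j \<in> M \<and> \<psi> j = k. push N M \<phi> x j)"
    using assms(2) by (intro sum.mono_neutral_cong_right) auto
  finally show "push N P (compose N \<psi> \<phi>) x k = push M P \<psi> (push N M \<phi> x) k"
    by (simp add: push_def[of _ P] fib)
qed

lemma push_sum_map:
  "push (N \<uplus> M) (N' \<uplus> M') (sum_map N M \<phi> \<psi>) (copair b c) =
    copair (push N N' \<phi> b) (push M M' \<psi> c)"
proof
  fix q
  show "push (N \<uplus> M) (N' \<uplus> M') (sum_map N M \<phi> \<psi>) (copair b c) q =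
    copair (push N N' \<phi> b) (push M M' \<psi> c) q"
  proof (cases q)
    case (InL j)
    have "{i. i \<in> N \<uplus> M \<and> sum_map N M \<phi> \<psi> i = InL j} = InL ` {i. i \<in> N \<and> \<phi> i = j}"
      by (auto simp: sum_map_def elim!: dsum_cases)
    then show ?thesis
      by (simp add: InL push_def sum.reindex inj_on_def)
  next
    case (InR j)
    have "{i. i \<in> N \<uplus> M \<and> sum_map N M \<phi> \<psi> i = InR j} = InR ` {i. i \<in> M \<and> \<psi> i = j}"
      by (auto simp: sum_map_def elim!: dsum_cases)
    then show ?thesis
      by (simp add: InR push_def sum.reindex inj_on_def)
  qed (simp add: push_def)
qed

lemma pull_affine:
  assumes "\<phi> \<in> N \<rightarrow> M"
  shows "pull N \<phi> (\<lambda>i\<in>M. (1 - t) * x i + t * y i) =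
    (\<lambda>i\<in>N. (1 - t) * pull N \<phi> x i + t * pull N \<phi> y i)"
  using assms by (auto simp: pull_def fun_eq_iff)

text \<open>
  The next two lemmas reparametrise infima over flows, for a relabelling of the edges and for a
  disjoint union of edge sets respectively.
\<close>

lemma pull_bij_image:
  assumes "bij_betw \<beta> E E'"
  shows "pull E \<beta> ` vecs E' = vecs E"
proof (intro equalityI subsetI)
  fix z assume z: "z \<in> vecs E"
  have "z = pull E \<beta> (\<lambda>e\<in>E'. z (inv_into E \<beta> e))"
    using assms z
    by (auto simp: pull_def vecs_def fun_eq_iff bij_betw_def PiE_def extensional_def)
  then show "z \<in> pull E \<beta> ` vecs E'"
    by (rule image_eqI[where f = "pull E \<beta>"]) (simp add: vecs_def)
qed auto

lemma pull_dsum_image: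
  "(\<lambda>x. (pull E InL x, pull E' InR x)) ` vecs (E \<uplus> E') = vecs E \<times> vecs E'"
proof (intro equalityI subsetI)
  fix p assume p: "p \<in> vecs E \<times> vecs E'"
  then have "copair (fst p) (snd p) \<in> vecs (E \<uplus> E')"
    by (auto simp: vecs_def mem_Times_iff intro!: copair_extensional)
  moreover have "p = (pull E InL (copair (fst p) (snd p)), pull E' InR (copair (fst p) (snd p)))"
    using p by (auto simp: pull_def vecs_def prod_eq_iff fun_eq_iff PiE_def extensional_def)
  ultimately show "p \<in> (\<lambda>x. (pull E InL x, pull E' InR x)) ` vecs (E \<uplus> E')"
    by (rule rev_image_eqI[where f = "\<lambda>x. (pull E InL x, pull E' InR x)"])
qed auto


section \<open>Flow networks form a lax symmetric monoidal functor\<close>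

lemma flow_networksD:
  assumes "G \<in> flow_networks N"
  shows "finite (edges G)" "src G \<in> edges G \<rightarrow>\<^sub>E N" "tgt G \<in> edges G \<rightarrow>\<^sub>E N"
    "cost G \<in> edges G \<rightarrow>\<^sub>E K" "vertex_supply G \<in> vecs N" "(\<Sum>v\<in>N. vertex_supply G v) = 0"
  using assms by (auto simp: flow_networks_def)

lemma flow_networks_endpoints [simp]:
  assumes "G \<in> flow_networks N" "e \<in> edges G"
  shows "src G e \<in> N" "tgt G e \<in> N"
  using assms by (auto simp: flow_networks_def)

lemma Ob_FlowNet [simp]: "Ob FlowNet = flow_networks"
  and Eq_FlowNet [simp]: "Eq FlowNet = flow_network_iso"
  by (simp_all add: FlowNet_def)

lemma Ar_FlowNet_sel [simp]:
  "edges (Ar FlowNet N M \<phi> G) = edges G"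
  "src (Ar FlowNet N M \<phi> G) = compose (edges G) \<phi> (src G)"
  "tgt (Ar FlowNet N M \<phi> G) = compose (edges G) \<phi> (tgt G)"
  "cost (Ar FlowNet N M \<phi> G) = cost G"
  "vertex_supply (Ar FlowNet N M \<phi> G) = push N M \<phi> (vertex_supply G)"
  by (simp_all add: FlowNet_def)

lemma Pr_FlowNet_sel [simp]:
  "edges (Pr FlowNet N M (G, H)) = edges G \<uplus> edges H"
  "src (Pr FlowNet N M (G, H)) = sum_map (edges G) (edges H) (src G) (src H)"
  "tgt (Pr FlowNet N M (G, H)) = sum_map (edges G) (edges H) (tgt G) (tgt H)"
  "cost (Pr FlowNet N M (G, H)) = copair (cost G) (cost H)"
  "vertex_supply (Pr FlowNet N M (G, H)) = copair (vertex_supply G) (vertex_supply H)"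
  by (simp_all add: FlowNet_def)

lemma Unt_FlowNet_sel [simp]:
  "edges (Unt FlowNet) = {}"
  "src (Unt FlowNet) = (\<lambda>_. undefined)"
  "tgt (Unt FlowNet) = (\<lambda>_. undefined)"
  "cost (Unt FlowNet) = (\<lambda>_. undefined)"
  "vertex_supply (Unt FlowNet) = (\<lambda>_. undefined)"
  by (simp_all add: FlowNet_def)

lemma Ar_FlowNet_closed:
  assumes "finite N" "finite M" "\<phi> \<in> N \<rightarrow>\<^sub>E M" "G \<in> flow_networks N"
  shows "Ar FlowNet N M \<phi> G \<in> flow_networks M"
proof -
  have "\<phi> \<in> N \<rightarrow> M" using assms by auto
  then show ?thesis
    using flow_networksD[OF assms(4)] assms sum_push[of N M \<phi> "vertex_supply G"]
    by (auto simp: flow_networks_def compose_def)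
qed

lemma Pr_FlowNet_closed:
  assumes "finite N" "finite M" "G \<in> flow_networks N" "H \<in> flow_networks M"
  shows "Pr FlowNet N M (G, H) \<in> flow_networks (N \<uplus> M)"
  using flow_networksD[OF assms(3)] flow_networksD[OF assms(4)] assms(1,2)
  by (simp add: flow_networks_def sum_map_closed copair_extensional vecs_def sum_dsum)

lemma Unt_FlowNet_closed: "Unt FlowNet \<in> flow_networks {}"
  by (auto simp: flow_networks_def vecs_def)

lemma flow_network_isoI:
  assumes "G \<in> flow_networks N" "H \<in> flow_networks N" "vertex_supply G = vertex_supply H"
    "bij_betw \<beta> (edges G) (edges H)"
    "\<And>e. e \<in> edges G \<Longrightarrow> src H (\<beta> e) = src G e"
    "\<And>e. e \<in> edges G \<Longrightarrow> tgt H (\<beta> e) = tgt G e"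
    "\<And>e. e \<in> edges G \<Longrightarrow> cost H (\<beta> e) = cost G e"
  shows "(G, H) \<in> flow_network_iso N"
  using assms unfolding flow_network_iso_def by blast

lemma flow_network_isoE:
  assumes "(G, H) \<in> flow_network_iso N"
  obtains \<beta> where "G \<in> flow_networks N" "H \<in> flow_networks N" "vertex_supply G = vertex_supply H"
    "bij_betw \<beta> (edges G) (edges H)"
    "\<And>e. e \<in> edges G \<Longrightarrow> src H (\<beta> e) = src G e"
    "\<And>e. e \<in> edges G \<Longrightarrow> tgt H (\<beta> e) = tgt G e"
    "\<And>e. e \<in> edges G \<Longrightarrow> cost H (\<beta> e) = cost G e"
    "\<And>e. e \<in> edges G \<Longrightarrow> \<beta> e \<in> edges H"
  using assms unfolding flow_network_iso_def by (auto simp: bij_betw_def)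

lemma flow_network_iso_refl: "G \<in> flow_networks N \<Longrightarrow> (G, G) \<in> flow_network_iso N"
  by (rule flow_network_isoI[where \<beta> = id]) auto

lemma flow_network_iso_sym:
  assumes "(G, H) \<in> flow_network_iso N"
  shows "(H, G) \<in> flow_network_iso N"
  using assms
proof (rule flow_network_isoE)
  fix \<beta>
  assume *: "G \<in> flow_networks N" "H \<in> flow_networks N" "vertex_supply G = vertex_supply H"
    and \<beta>: "bij_betw \<beta> (edges G) (edges H)"
    and eqs: "\<And>e. e \<in> edges G \<Longrightarrow> src H (\<beta> e) = src G e"
    "\<And>e. e \<in> edges G \<Longrightarrow> tgt H (\<beta> e) = tgt G e"
    "\<And>e. e \<in> edges G \<Longrightarrow> cost H (\<beta> e) = cost G e"
  let ?\<gamma> = "inv_into (edges G) \<beta>"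
  have \<gamma>: "?\<gamma> e \<in> edges G" "\<beta> (?\<gamma> e) = e" if "e \<in> edges H" for e
    using \<beta> that by (auto simp: bij_betw_def inv_into_into f_inv_into_f)
  show ?thesis
    using * bij_betw_inv_into[OF \<beta>] eqs[OF \<gamma>(1)] \<gamma>(2)
    by (intro flow_network_isoI[where \<beta> = ?\<gamma>]) auto
qed

lemma flow_network_iso_trans:
  assumes "(G, H) \<in> flow_network_iso N" "(H, J) \<in> flow_network_iso N"
  shows "(G, J) \<in> flow_network_iso N"
  using assms(1)
proof (rule flow_network_isoE)
  fix \<beta>
  assume G: "G \<in> flow_networks N" "vertex_supply G = vertex_supply H"
    "bij_betw \<beta> (edges G) (edges H)"
    "\<And>e. e \<in> edges G \<Longrightarrow> src H (\<beta> e) = src G e"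
    "\<And>e. e \<in> edges G \<Longrightarrow> tgt H (\<beta> e) = tgt G e"
    "\<And>e. e \<in> edges G \<Longrightarrow> cost H (\<beta> e) = cost G e"
    "\<And>e. e \<in> edges G \<Longrightarrow> \<beta> e \<in> edges H"
  from assms(2) show ?thesis
  proof (rule flow_network_isoE)
    fix \<gamma>
    assume H: "J \<in> flow_networks N" "vertex_supply H = vertex_supply J"
      "bij_betw \<gamma> (edges H) (edges J)"
      "\<And>e. e \<in> edges H \<Longrightarrow> src J (\<gamma> e) = src H e"
      "\<And>e. e \<in> edges H \<Longrightarrow> tgt J (\<gamma> e) = tgt H e"
      "\<And>e. e \<in> edges H \<Longrightarrow> cost J (\<gamma> e) = cost H e"
    show ?thesis
      using G H bij_betw_trans[OF G(3) H(3)]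
      by (intro flow_network_isoI[where \<beta> = "\<gamma> \<circ> \<beta>"]) auto
  qed
qed

lemma equiv_flow_network_iso: "equiv (flow_networks N) (flow_network_iso N)"
proof (rule equivI)
  show "flow_network_iso N \<subseteq> flow_networks N \<times> flow_networks N"
    by (auto simp: flow_network_iso_def)
  show "refl_on (flow_networks N) (flow_network_iso N)"
    by (auto intro!: refl_onI flow_network_iso_refl)
  show "sym (flow_network_iso N)"
    by (auto intro!: symI flow_network_iso_sym)
  show "trans (flow_network_iso N)"
    by (auto intro!: transI intro: flow_network_iso_trans)
qed

lemma Ar_FlowNet_iso:
  assumes "finite N" "finite M" "\<phi> \<in> N \<rightarrow>\<^sub>E M" "(G, H) \<in> flow_network_iso N"
  shows "(Ar FlowNet N M \<phi> G, Ar FlowNet N M \<phi> H) \<in> flow_network_iso M"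
  using assms(4)
proof (rule flow_network_isoE)
  fix \<beta>
  assume "G \<in> flow_networks N" "H \<in> flow_networks N" "vertex_supply G = vertex_supply H"
    "bij_betw \<beta> (edges G) (edges H)"
    "\<And>e. e \<in> edges G \<Longrightarrow> src H (\<beta> e) = src G e"
    "\<And>e. e \<in> edges G \<Longrightarrow> tgt H (\<beta> e) = tgt G e"
    "\<And>e. e \<in> edges G \<Longrightarrow> cost H (\<beta> e) = cost G e"
    "\<And>e. e \<in> edges G \<Longrightarrow> \<beta> e \<in> edges H"
  with assms(1-3) show ?thesis
    by (intro flow_network_isoI[where \<beta> = \<beta>] Ar_FlowNet_closed) (auto simp: compose_eq)
qed

lemma Pr_FlowNet_iso:
  assumes "finite N" "finite M" "(G, G') \<in> flow_network_iso N" "(H, H') \<in> flow_network_iso M"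
  shows "(Pr FlowNet N M (G, H), Pr FlowNet N M (G', H')) \<in> flow_network_iso (N \<uplus> M)"
  using assms(3)
proof (rule flow_network_isoE)
  fix \<beta>
  assume G: "G \<in> flow_networks N" "G' \<in> flow_networks N" "vertex_supply G = vertex_supply G'"
    "bij_betw \<beta> (edges G) (edges G')"
    "\<And>e. e \<in> edges G \<Longrightarrow> src G' (\<beta> e) = src G e"
    "\<And>e. e \<in> edges G \<Longrightarrow> tgt G' (\<beta> e) = tgt G e"
    "\<And>e. e \<in> edges G \<Longrightarrow> cost G' (\<beta> e) = cost G e"
    "\<And>e. e \<in> edges G \<Longrightarrow> \<beta> e \<in> edges G'"
  from assms(4) show ?thesis
  proof (rule flow_network_isoE)
    fix \<gamma>
    assume H: "H \<in> flow_networks M" "H' \<in> flow_networks M" "vertex_supply H = vertex_supply H'"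
      "bij_betw \<gamma> (edges H) (edges H')"
      "\<And>e. e \<in> edges H \<Longrightarrow> src H' (\<gamma> e) = src H e"
      "\<And>e. e \<in> edges H \<Longrightarrow> tgt H' (\<gamma> e) = tgt H e"
      "\<And>e. e \<in> edges H \<Longrightarrow> cost H' (\<gamma> e) = cost H e"
      "\<And>e. e \<in> edges H \<Longrightarrow> \<gamma> e \<in> edges H'"
    let ?\<delta> = "copair (InL \<circ> \<beta>) (InR \<circ> \<gamma>)"
    have "inj_on ?\<delta> (edges G \<uplus> edges H)"
      using bij_betw_imp_inj_on[OF G(4)] bij_betw_imp_inj_on[OF H(4)]
      by (intro inj_onI) (auto elim!: dsum_cases dest: inj_onD)
    moreover have "?\<delta> ` (edges G \<uplus> edges H) = edges G' \<uplus> edges H'"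
    proof -
      have "edges G' = \<beta> ` edges G" "edges H' = \<gamma> ` edges H"
        using G(4) H(4) by (auto simp: bij_betw_def)
      then show ?thesis
        by (simp add: dsum_def image_Un image_image)
    qed
    ultimately have "bij_betw ?\<delta> (edges G \<uplus> edges H) (edges G' \<uplus> edges H')"
      by (simp add: bij_betw_def)
    moreover have "Pr FlowNet N M (G, H) \<in> flow_networks (N \<uplus> M)"
      "Pr FlowNet N M (G', H') \<in> flow_networks (N \<uplus> M)"
      using G(1,2) H(1,2) assms(1,2) by (auto intro: Pr_FlowNet_closed)
    ultimately show ?thesis
      using G(3,5-8) H(3,5-8)
      by (intro flow_network_isoI[where \<beta> = ?\<delta>]) (auto elim!: dsum_cases)
  qed
qed

interpretation FlowNet: lax_symmetric_monoidal_functor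
  "FlowNet :: ('a, ('a, 'e) flow_network) lax_data"
proof
  fix N M P N' M' :: "'a point set" and \<phi> \<psi> :: "'a point \<Rightarrow> 'a point"
    and G G' H H' J :: "('a, 'e) flow_network"
  assume fin: "finite N"
  show "equiv (Ob FlowNet N) (Eq FlowNet N :: (('a, 'e) flow_network \<times> _) set)"
    by (simp add: equiv_flow_network_iso)
  show "Ar FlowNet N N (\<lambda>i\<in>N. i) G = G" if "G \<in> Ob FlowNet N"
    using flow_networksD[of G N] that
    by (intro flow_network.equality)
      (auto simp: push_id fun_eq_iff compose_def PiE_def Pi_iff extensional_def)
  show "(Ar FlowNet ({} \<uplus> N) N (left_unitor N) (Pr FlowNet {} N (Unt FlowNet, G)), G)
    \<in> Eq FlowNet N" if "G \<in> Ob FlowNet N"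
    using that fin flow_networksD[of G N]
    by (simp, intro flow_network_isoI[where \<beta> = "left_unitor (edges G)"])
      (auto intro!: Ar_FlowNet_closed Pr_FlowNet_closed Unt_FlowNet_closed left_unitor_closed
         push_bij bij_left_unitor simp: compose_eq elim!: dsum_cases)
  show "(Ar FlowNet (N \<uplus> {}) N (right_unitor N) (Pr FlowNet N {} (G, Unt FlowNet)), G)
    \<in> Eq FlowNet N" if "G \<in> Ob FlowNet N"
    using that fin flow_networksD[of G N]
    by (simp, intro flow_network_isoI[where \<beta> = "right_unitor (edges G)"])
      (auto intro!: Ar_FlowNet_closed Pr_FlowNet_closed Unt_FlowNet_closed right_unitor_closed
         push_bij bij_right_unitor simp: compose_eq elim!: dsum_cases)
  assume fin': "finite M"
  show "Ar FlowNet N M \<phi> G \<in> Ob FlowNet M" if "\<phi> \<in> N \<rightarrow>\<^sub>E M" "G \<in> Ob FlowNet N"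
    using that fin fin' by (simp add: Ar_FlowNet_closed)
  show "(Ar FlowNet N M \<phi> G, Ar FlowNet N M \<phi> G') \<in> Eq FlowNet M"
    if "\<phi> \<in> N \<rightarrow>\<^sub>E M" "(G, G') \<in> Eq FlowNet N"
    using that fin fin' by (simp add: Ar_FlowNet_iso)
  show "Pr FlowNet N M (G, H) \<in> Ob FlowNet (N \<uplus> M)" if "G \<in> Ob FlowNet N" "H \<in> Ob FlowNet M"
    using that fin fin' by (simp add: Pr_FlowNet_closed)
  show "(Pr FlowNet N M (G, H), Pr FlowNet N M (G', H')) \<in> Eq FlowNet (N \<uplus> M)"
    if "(G, G') \<in> Eq FlowNet N" "(H, H') \<in> Eq FlowNet M"
    using that fin fin' by (simp add: Pr_FlowNet_iso)
  show "(Ar FlowNet (N \<uplus> M) (M \<uplus> N) (braiding N M) (Pr FlowNet N M (G, H)),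
      Pr FlowNet M N (H, G)) \<in> Eq FlowNet (M \<uplus> N)" if "G \<in> Ob FlowNet N" "H \<in> Ob FlowNet M"
    using that fin fin' flow_networksD[of G N] flow_networksD[of H M]
    by (simp, intro flow_network_isoI[where \<beta> = "braiding (edges G) (edges H)"])
      (auto intro!: Ar_FlowNet_closed Pr_FlowNet_closed braiding_closed
         push_bij bij_braiding copair_extensional[folded vecs_def]
         simp: compose_eq vecs_def elim!: dsum_cases)
  assume fin'': "finite P"
  show "Ar FlowNet N P (compose N \<psi> \<phi>) G = Ar FlowNet M P \<psi> (Ar FlowNet N M \<phi> G)"
    if "\<phi> \<in> N \<rightarrow>\<^sub>E M" "\<psi> \<in> M \<rightarrow>\<^sub>E P" "G \<in> Ob FlowNet N"
    using that fin fin' flow_networksD[of G N] push_compose[of N M \<phi> P \<psi> "vertex_supply G"]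
    by (intro flow_network.equality) (auto simp: fun_eq_iff compose_def)
  show "(Ar FlowNet ((N \<uplus> M) \<uplus> P) (N \<uplus> (M \<uplus> P)) (associator N M P)
       (Pr FlowNet (N \<uplus> M) P (Pr FlowNet N M (G, H), J)),
     Pr FlowNet N (M \<uplus> P) (G, Pr FlowNet M P (H, J))) \<in> Eq FlowNet (N \<uplus> (M \<uplus> P))"
    if "G \<in> Ob FlowNet N" "H \<in> Ob FlowNet M" "J \<in> Ob FlowNet P"
    using that fin fin' fin'' flow_networksD[of G N] flow_networksD[of H M] flow_networksD[of J P]
    by (simp, intro flow_network_isoI[where \<beta> = "associator (edges G) (edges H) (edges J)"])
      (auto intro!: Ar_FlowNet_closed Pr_FlowNet_closed associator_closed
         push_bij bij_associator copair_extensional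
         simp: compose_eq vecs_def elim!: dsum_cases)
next
  fix N M N' M' :: "'a point set" and \<phi> \<psi> :: "'a point \<Rightarrow> 'a point"
    and G H :: "('a, 'e) flow_network"
  assume "G \<in> Ob FlowNet N" "H \<in> Ob FlowNet M"
  then have "src G \<in> edges G \<rightarrow> N" "tgt G \<in> edges G \<rightarrow> N"
      "src H \<in> edges H \<rightarrow> M" "tgt H \<in> edges H \<rightarrow> M"
    by auto
  then show "Ar FlowNet (N \<uplus> M) (N' \<uplus> M') (sum_map N M \<phi> \<psi>) (Pr FlowNet N M (G, H))
        = Pr FlowNet N' M' (Ar FlowNet N N' \<phi> G, Ar FlowNet M M' \<psi> H)"
    by (intro flow_network.equality)
      (auto simp: push_sum_map compose_sum_map)
next
  show "Unt FlowNet \<in> Ob FlowNet {}"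
    by (simp add: Unt_FlowNet_closed)
qed


section \<open>Concave functions form a lax symmetric monoidal functor\<close>

lemma Ob_Conc [simp]: "Ob Conc = concave_functions"
  and Eq_Conc [simp]: "Eq Conc N = Id_on (concave_functions N)"
  and Ar_Conc [simp]: "Ar Conc N M \<phi> f = compose (vecs M) f (pull N \<phi>)"
  and Pr_Conc [simp]:
    "Pr Conc N M (f, g) = (\<lambda>y\<in>vecs (N \<uplus> M). f (pull N InL y) + g (pull M InR y))"
  and Unt_Conc [simp]: "Unt Conc = (\<lambda>y\<in>vecs {}. 0)"
  by (simp_all add: Conc_def)

lemma vecs_restrict [simp]: "restrict h N \<in> vecs N"
  by (simp add: vecs_def)

lemma concave_functionsD:
  assumes "f \<in> concave_functions N"
  shows "f \<in> extensional (vecs N)" "\<And>x. x \<in> vecs N \<Longrightarrow> f x \<noteq> \<infinity>"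
    "\<And>x y t. \<lbrakk>x \<in> vecs N; y \<in> vecs N; 0 < t; t < 1\<rbrakk> \<Longrightarrow>
      ereal (1 - t) * f x + ereal t * f y \<le> f (\<lambda>i\<in>N. (1 - t) * x i + t * y i)"
  using assms by (auto simp: concave_functions_def PiE_def)

lemma concave_functionsI:
  assumes "f \<in> extensional (vecs N)" "\<And>x. x \<in> vecs N \<Longrightarrow> f x \<noteq> \<infinity>"
    "\<And>x y t. \<lbrakk>x \<in> vecs N; y \<in> vecs N; 0 < t; t < 1\<rbrakk> \<Longrightarrow>
      ereal (1 - t) * f x + ereal t * f y \<le> f (\<lambda>i\<in>N. (1 - t) * x i + t * y i)"
  shows "f \<in> concave_functions N"
  using assms by (auto simp: concave_functions_def PiE_def)

lemma ereal_distrib_nonneg_left: "0 \<le> c \<Longrightarrow> ereal c * (a + b) = ereal c * a + ereal c * b"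
  using distrib_left_ereal_nn[of c a b] by (simp add: mult.commute)

lemma Ar_Conc_closed:
  assumes "\<phi> \<in> N \<rightarrow> M" "f \<in> concave_functions N"
  shows "compose (vecs M) f (pull N \<phi>) \<in> concave_functions M"
  using concave_functionsD[OF assms(2)]
  by (intro concave_functionsI) (simp_all add: compose_def pull_affine[OF assms(1)])

text \<open>
  The two concavity inequalities may be added, because nonnegative real scalars distribute over
  sums of extended reals and the pullbacks commute with convex combinations.
\<close>

lemma Pr_Conc_closed:
  assumes "f \<in> concave_functions N" "g \<in> concave_functions M"
  shows "(\<lambda>y\<in>vecs (N \<uplus> M). f (pull N InL y) + g (pull M InR y)) \<in> concave_functions (N \<uplus> M)"
proof (rule concave_functionsI)
  note f = concave_functionsD[OF assms(1)] and g = concave_functionsD[OF assms(2)]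
  show "(\<lambda>y\<in>vecs (N \<uplus> M). f (pull N InL y) + g (pull M InR y)) x \<noteq> \<infinity>"
    if "x \<in> vecs (N \<uplus> M)" for x
    using that f(2) g(2) by simp
  fix x y and t :: real
  assume xy: "x \<in> vecs (N \<uplus> M)" "y \<in> vecs (N \<uplus> M)" and t: "0 < t" "t < 1"
  let ?z = "\<lambda>i\<in>N \<uplus> M. (1 - t) * x i + t * y i"
  have "ereal (1 - t) * (f (pull N InL x) + g (pull M InR x))
      + ereal t * (f (pull N InL y) + g (pull M InR y))
    = (ereal (1 - t) * f (pull N InL x) + ereal t * f (pull N InL y))
      + (ereal (1 - t) * g (pull M InR x) + ereal t * g (pull M InR y))"
    using t by (simp add: ereal_distrib_nonneg_left ac_simps)
  also have "\<dots> \<le> f (pull N InL ?z) + g (pull M InR ?z)"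
    using f(3)[of "pull N InL x" "pull N InL y" t] g(3)[of "pull M InR x" "pull M InR y" t] t
    by (intro add_mono) (simp_all add: pull_affine)
  finally show "ereal (1 - t) * (\<lambda>y\<in>vecs (N \<uplus> M). f (pull N InL y) + g (pull M InR y)) x
      + ereal t * (\<lambda>y\<in>vecs (N \<uplus> M). f (pull N InL y) + g (pull M InR y)) y
    \<le> (\<lambda>y\<in>vecs (N \<uplus> M). f (pull N InL y) + g (pull M InR y)) ?z"
    using xy by simp
qed simp

lemma pull_pull: "\<phi> \<in> N \<rightarrow> M \<Longrightarrow> pull N \<phi> (pull M \<psi> y) = pull N (compose N \<psi> \<phi>) y"
  by (auto simp: pull_def compose_def fun_eq_iff)

lemma pull_id: "y \<in> vecs N \<Longrightarrow> (\<And>i. i \<in> N \<Longrightarrow> \<phi> i = i) \<Longrightarrow> pull N \<phi> y = y"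
  by (auto simp: pull_def vecs_def fun_eq_iff PiE_def extensional_def)

interpretation Conc: lax_symmetric_monoidal_functor
  "Conc :: ('a, ('a point \<Rightarrow> real) \<Rightarrow> ereal) lax_data"
proof
  fix N M P N' M' :: "'a point set" and \<phi> \<psi> :: "'a point \<Rightarrow> 'a point"
    and f f' g g' h :: "('a point \<Rightarrow> real) \<Rightarrow> ereal"
  show "equiv (Ob Conc N) (Eq Conc N)"
    by (auto intro!: equivI refl_onI symI transI)
  show Ar: "Ar Conc N M \<phi> f \<in> Ob Conc M" if "\<phi> \<in> N \<rightarrow>\<^sub>E M" "f \<in> Ob Conc N" for N M \<phi> f
    using that by (auto intro: Ar_Conc_closed)
  show Pr: "Pr Conc N M (f, g) \<in> Ob Conc (N \<uplus> M)" if "f \<in> Ob Conc N" "g \<in> Ob Conc M" for N M f g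
    using that by (auto intro: Pr_Conc_closed)
  show U: "Unt Conc \<in> Ob Conc {}"
    by (auto intro!: concave_functionsI)
  show "(Ar Conc N M \<phi> f, Ar Conc N M \<phi> f') \<in> Eq Conc M"
    if "\<phi> \<in> N \<rightarrow>\<^sub>E M" "(f, f') \<in> Eq Conc N"
    using that Ar[of \<phi> N M f] by (auto simp: Id_on_def)
  show "(Pr Conc N M (f, g), Pr Conc N M (f', g')) \<in> Eq Conc (N \<uplus> M)"
    if "(f, f') \<in> Eq Conc N" "(g, g') \<in> Eq Conc M"
    using that Pr[of f N g M] by (auto simp: Id_on_def)
  show "Ar Conc N N (\<lambda>i\<in>N. i) f = f" if "f \<in> Ob Conc N"
    using concave_functionsD(1)[of f N] that
    by (auto simp: compose_def fun_eq_iff pull_id extensional_def)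
  show "Ar Conc N P (compose N \<psi> \<phi>) f = Ar Conc M P \<psi> (Ar Conc N M \<phi> f)" if "\<phi> \<in> N \<rightarrow>\<^sub>E M"
    using that by (auto simp: compose_def fun_eq_iff pull_def intro!: arg_cong[where f = f])
  show "Ar Conc (N \<uplus> M) (N' \<uplus> M') (sum_map N M \<phi> \<psi>) (Pr Conc N M (f, g))
        = Pr Conc N' M' (Ar Conc N N' \<phi> f, Ar Conc M M' \<psi> g)"
    if "\<phi> \<in> N \<rightarrow>\<^sub>E N'" "\<psi> \<in> M \<rightarrow>\<^sub>E M'"
    using that
    by (auto simp: fun_eq_iff compose_def pull_def intro!: arg_cong2[where f = "(+)"]
        arg_cong[where f = f] arg_cong[where f = g])
  \<comment> \<open>Both sides of a coherence diagram are extensional, so they may be compared pointwise.\<close>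
  have Eq: "(u, v) \<in> Eq Conc Q"
    if "u \<in> Ob Conc Q" "v \<in> Ob Conc Q" "\<And>y. y \<in> vecs Q \<Longrightarrow> u y = v y"
    for Q :: "'a point set" and u v :: "('a point \<Rightarrow> real) \<Rightarrow> ereal"
    using that extensionalityI[of u "vecs Q" v] by (auto simp: Id_on_iff dest: concave_functionsD(1))
  show "(Ar Conc ((N \<uplus> M) \<uplus> P) (N \<uplus> (M \<uplus> P)) (associator N M P)
             (Pr Conc (N \<uplus> M) P (Pr Conc N M (f, g), h)),
           Pr Conc N (M \<uplus> P) (f, Pr Conc M P (g, h))) \<in> Eq Conc (N \<uplus> (M \<uplus> P))"
    if "f \<in> Ob Conc N" "g \<in> Ob Conc M" "h \<in> Ob Conc P"
    using that
    by (intro Eq Ar Pr associator_closed)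
      (auto simp: compose_eq pull_pull add.assoc intro!: arg_cong2[where f = "(+)"]
        arg_cong[where f = f] arg_cong[where f = g] arg_cong[where f = h] simp: pull_def)
  show "(Ar Conc ({} \<uplus> N) N (left_unitor N) (Pr Conc {} N (Unt Conc, f)), f) \<in> Eq Conc N"
    if "f \<in> Ob Conc N"
    using that
    by (intro Eq Ar Pr U left_unitor_closed)
      (auto simp: compose_eq pull_pull pull_id)
  show "(Ar Conc (N \<uplus> {}) N (right_unitor N) (Pr Conc N {} (f, Unt Conc)), f) \<in> Eq Conc N"
    if "f \<in> Ob Conc N"
    using that
    by (intro Eq Ar Pr U right_unitor_closed)
      (auto simp: compose_eq pull_pull pull_id)
  show "(Ar Conc (N \<uplus> M) (M \<uplus> N) (braiding N M) (Pr Conc N M (f, g)),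
           Pr Conc M N (g, f)) \<in> Eq Conc (M \<uplus> N)"
    if "f \<in> Ob Conc N" "g \<in> Ob Conc M"
    using that
    by (intro Eq Ar Pr braiding_closed)
      (auto simp: compose_eq add.commute intro!: arg_cong2[where f = "(+)"]
        arg_cong[where f = f] arg_cong[where f = g] simp: pull_def)
qed


section \<open>The dual function of a flow network\<close>

definition lagrangian ::
    "'a point set \<Rightarrow> ('a, 'e) flow_network \<Rightarrow> ('a point \<Rightarrow> real) \<Rightarrow> ('e point \<Rightarrow> real) \<Rightarrow> real"
  where "lagrangian N G y x = (\<Sum>e\<in>edges G. cost G e (x e))
    + (\<Sum>v\<in>N. y v * ((\<Sum>e\<in>edges G. incidence G v e * x e) - vertex_supply G v))"

definition netflow ::
    "'a point set \<Rightarrow> ('a, 'e) flow_network \<Rightarrow> ('a point \<Rightarrow> real) \<Rightarrow> ereal"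
  where "netflow N G = (\<lambda>y\<in>vecs N. INF x\<in>vecs (edges G). ereal (lagrangian N G y x))"

lemma vecs_nonempty [simp]: "vecs N \<noteq> {}"
  by (simp add: vecs_def PiE_eq_empty_iff)

lemma sum_incidence:
  assumes "finite N" "src G e \<in> N" "tgt G e \<in> N"
  shows "(\<Sum>v\<in>N. y v * incidence G v e) = y (src G e) - y (tgt G e)"
proof -
  have "y v * incidence G v e =
      (if src G e = v then y v else 0) - (if tgt G e = v then y v else 0)" for v
    by (auto simp: incidence_def)
  then show ?thesis
    using assms by (simp add: sum_subtractf)
qed

text \<open>
  Exchanging the sums over vertices and edges leaves, for each edge, the pairing of \<open>y\<close> with a
  column of the incidence matrix, which is the tension of that edge.
\<close>

lemma lagrangian_tension:
  assumes "finite N" "G \<in> flow_networks N"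
  shows "lagrangian N G y x =
    (\<Sum>e\<in>edges G. cost G e (x e) + (y (src G e) - y (tgt G e)) * x e)
      - (\<Sum>v\<in>N. y v * vertex_supply G v)"
proof -
  have "(\<Sum>v\<in>N. y v * (\<Sum>e\<in>edges G. incidence G v e * x e)) =
      (\<Sum>e\<in>edges G. (\<Sum>v\<in>N. y v * incidence G v e) * x e)"
    unfolding sum_distrib_left sum_distrib_right
    by (subst sum.swap) (simp add: mult.assoc)
  also have "\<dots> = (\<Sum>e\<in>edges G. (y (src G e) - y (tgt G e)) * x e)"
    using assms by (intro sum.cong) (simp_all add: sum_incidence)
  finally show ?thesis
    by (simp add: lagrangian_def right_diff_distrib sum_subtractf sum.distrib)
qed

lemma lagrangian_affine:
  "lagrangian N G (\<lambda>v\<in>N. (1 - t) * y v + t * z v) x =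
    (1 - t) * lagrangian N G y x + t * lagrangian N G z x"
  by (simp add: lagrangian_def algebra_simps sum.distrib sum_subtractf sum_distrib_left)

lemma INF_ereal_not_PInf:
  assumes "I \<noteq> {}"
  shows "(INF i\<in>I. ereal (a i)) \<noteq> \<infinity>"
proof -
  obtain i where "i \<in> I" using assms by auto
  then have "(INF i\<in>I. ereal (a i)) \<le> ereal (a i)"
    by (rule INF_lower)
  then show ?thesis by auto
qed

text \<open>
  A convex combination of two values of the infimum is at most the same combination of the
  Lagrangians at any one flow, and that is the Lagrangian at the combined potential.
\<close>

lemma netflow_concave: "netflow N G \<in> concave_functions N"
proof (rule concave_functionsI)
  show "netflow N G \<in> extensional (vecs N)"
    by (simp add: netflow_def)
  show "netflow N G y \<noteq> \<infinity>" if y: "y \<in> vecs N" for y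
    using y by (simp add: netflow_def INF_ereal_not_PInf)
  fix y z and t :: real
  assume y: "y \<in> vecs N" and z: "z \<in> vecs N" and t: "0 < t" "t < 1"
  have "ereal (1 - t) * netflow N G y + ereal t * netflow N G z
      \<le> ereal (lagrangian N G (\<lambda>v\<in>N. (1 - t) * y v + t * z v) x)"
    if x: "x \<in> vecs (edges G)" for x
  proof -
    have "ereal (1 - t) * netflow N G y + ereal t * netflow N G z
      \<le> ereal (1 - t) * ereal (lagrangian N G y x) + ereal t * ereal (lagrangian N G z x)"
      using x y z t
      by (intro add_mono ereal_mult_left_mono) (auto simp: netflow_def intro: INF_lower)
    then show ?thesis
      by (simp add: lagrangian_affine)
  qed
  then show "ereal (1 - t) * netflow N G y + ereal t * netflow N G z
      \<le> netflow N G (\<lambda>v\<in>N. (1 - t) * y v + t * z v)"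
    by (simp add: netflow_def[of N G] INF_greatest)
qed

lemma netflow_iso:
  assumes "finite N" "(G, H) \<in> flow_network_iso N"
  shows "netflow N G = netflow N H"
  using assms(2)
proof (rule flow_network_isoE)
  fix \<beta>
  assume G: "G \<in> flow_networks N" and H: "H \<in> flow_networks N"
    and b: "vertex_supply G = vertex_supply H"
    and \<beta>: "bij_betw \<beta> (edges G) (edges H)"
    and eqs: "\<And>e. e \<in> edges G \<Longrightarrow> src H (\<beta> e) = src G e"
    "\<And>e. e \<in> edges G \<Longrightarrow> tgt H (\<beta> e) = tgt G e"
    "\<And>e. e \<in> edges G \<Longrightarrow> cost H (\<beta> e) = cost G e"
  have "lagrangian N G y (pull (edges G) \<beta> x) = lagrangian N H y x" for y x
    unfolding lagrangian_tension[OF assms(1) G] lagrangian_tension[OF assms(1) H]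
      sum.reindex_bij_betw[OF \<beta>, symmetric]
    by (simp add: b eqs pull_def)
  then show ?thesis
    by (simp add: netflow_def image_image flip: pull_bij_image[OF \<beta>])
qed

text \<open>
  The two sides are infima over the same set of flows, and their Lagrangians agree flow by flow.
\<close>

lemma netflow_natural:
  assumes "finite N" "finite M" "\<phi> \<in> N \<rightarrow>\<^sub>E M" "G \<in> flow_networks N"
  shows "compose (vecs M) (netflow N G) (pull N \<phi>) = netflow M (Ar FlowNet N M \<phi> G)"
proof -
  have "lagrangian N G (pull N \<phi> y) x = lagrangian M (Ar FlowNet N M \<phi> G) y x" for y x
  proof -
    have "(\<Sum>v\<in>N. y (\<phi> v) * vertex_supply G v)
        = (\<Sum>w\<in>M. y w * push N M \<phi> (vertex_supply G) w)"
      using assms by (intro sum_pull_push) auto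
    then show ?thesis
      unfolding lagrangian_tension[OF assms(1,4)]
        lagrangian_tension[OF assms(2) Ar_FlowNet_closed[OF assms]]
      using assms(4) by (simp add: pull_def compose_eq)
  qed
  then show ?thesis
    by (auto simp: fun_eq_iff compose_def netflow_def)
qed

text \<open>
  Addition of a constant commutes with suprema of extended reals as soon as the constant is not
  \<open>-\<infinity>\<close>. The proof passes to negatives, where this is the fact that infima of real values over a
  nonempty set are not \<open>\<infinity>\<close>.
\<close>

lemma INF_add_Times:
  fixes a :: "'i \<Rightarrow> real" and b :: "'j \<Rightarrow> real"
  assumes "I \<noteq> {}" "J \<noteq> {}"
  shows "(INF p\<in>I \<times> J. ereal (a (fst p) + b (snd p))) =
    (INF i\<in>I. ereal (a i)) + (INF j\<in>J. ereal (b j))"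
proof -
  have neg: "(SUP k\<in>S. - ereal (c k)) = - (INF k\<in>S. ereal (c k))" for S :: "'k set" and c
    by (rule ereal_SUP_uminus_eq)
  have A: "(INF i\<in>I. ereal (a i)) \<noteq> \<infinity>" and B: "(INF j\<in>J. ereal (b j)) \<noteq> \<infinity>"
    using assms by (simp_all add: INF_ereal_not_PInf)
  have "I \<times> J = (\<Union>i\<in>I. Pair i ` J)"
    by auto
  then have "(SUP p\<in>I \<times> J. - ereal (a (fst p) + b (snd p)))
      = (SUP i\<in>I. SUP j\<in>J. - ereal (a i) + - ereal (b j))"
    by (simp add: SUP_UNION image_image)
  also have "\<dots> = (SUP i\<in>I. - ereal (a i) + (SUP j\<in>J. - ereal (b j)))"
    by (intro SUP_cong refl SUP_ereal_add_right[OF assms(2)]) simp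
  also have "\<dots> = (SUP i\<in>I. - ereal (a i)) + (SUP j\<in>J. - ereal (b j))"
    by (rule SUP_ereal_add_left[OF assms(1)]) (use B in \<open>simp only: neg\<close>, simp)
  finally have "- (INF p\<in>I \<times> J. ereal (a (fst p) + b (snd p)))
      = - (INF i\<in>I. ereal (a i)) + - (INF j\<in>J. ereal (b j))"
    by (simp only: ereal_SUP_uminus_eq)
  with A B show ?thesis
    by (cases "INF i\<in>I. ereal (a i)"; cases "INF j\<in>J. ereal (b j)";
        cases "INF p\<in>I \<times> J. ereal (a (fst p) + b (snd p))") auto
qed

lemma netflow_product:
  assumes "finite N" "finite M" "G \<in> flow_networks N" "H \<in> flow_networks M"
  shows "netflow (N \<uplus> M) (Pr FlowNet N M (G, H)) =
    (\<lambda>y\<in>vecs (N \<uplus> M). netflow N G (pull N InL y) + netflow M H (pull M InR y))"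
proof -
  have "lagrangian (N \<uplus> M) (Pr FlowNet N M (G, H)) y x =
      lagrangian N G (pull N InL y) (pull (edges G) InL x)
      + lagrangian M H (pull M InR y) (pull (edges H) InR x)" for y x
    unfolding lagrangian_tension[OF assms(1,3)] lagrangian_tension[OF assms(2,4)]
      lagrangian_tension[OF finite_dsum[OF assms(1,2)] Pr_FlowNet_closed[OF assms]]
    using assms flow_networksD(1)[OF assms(3)] flow_networksD(1)[OF assms(4)]
    by (simp add: sum_dsum pull_def sum_map_def)
  then have "(INF x\<in>vecs (edges G \<uplus> edges H). ereal (lagrangian (N \<uplus> M) (Pr FlowNet N M (G, H)) y x))
      = (INF p\<in>vecs (edges G) \<times> vecs (edges H).
          ereal (lagrangian N G (pull N InL y) (fst p) + lagrangian M H (pull M InR y) (snd p)))" for y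
    by (simp add: image_image flip: pull_dsum_image)
  then show ?thesis
    by (simp add: netflow_def INF_add_Times fun_eq_iff)
qed

lemma netflow_unit: "netflow {} (Unt FlowNet) = (\<lambda>y\<in>vecs {}. 0)"
  by (simp add: netflow_def lagrangian_def zero_ereal_def cong: restrict_cong)

interpretation netflow: monoidal_natural_transformation
  "FlowNet :: ('a, ('a, 'e) flow_network) lax_data" Conc netflow
  by unfold_locales
    (auto simp: netflow_concave netflow_natural netflow_product netflow_unit Id_on_iff
       dest: netflow_iso)

theorem theorem6p2:
  shows "\<exists>netflow :: 'a point set \<Rightarrow> ('a, 'e) flow_network \<Rightarrow> ('a point \<Rightarrow> real) \<Rightarrow> ereal.
    monoidal_natural_transformation FlowNet Conc netflow \<and>
    (\<forall>N. finite N \<longrightarrow> (\<forall>G\<in>Ob FlowNet N. \<forall>y\<in>vecs N.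
      netflow N G y =
        (INF x\<in>vecs (edges G).
          ereal ((\<Sum>e\<in>edges G. cost G e (x e))
               + (\<Sum>v\<in>N. y v * ((\<Sum>e\<in>edges G. incidence G v e * x e) - vertex_supply G v))))))"
  using netflow.monoidal_natural_transformation_axioms
  by (intro exI[of _ netflow]) (auto simp: netflow_def lagrangian_def)

end
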